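(* The relations $E^{\mathrm{ce}}_1$, $E^{\mathrm{ce}}_3$, $E^{\mathrm{ce}}_{\mathrm{set}}$, and $E^{\mathrm{ce}}_{\max}$ are pairwise incomparable under $\leq_{\mathrm{Learn}}$.
   Context: Fix a standard (acceptable) enumeration $(\varphi_e)_{e\in\omega}$ of the partial computable functions and let $W_e=\operatorname{dom}(\varphi_e)$. Write $e=^{\mathrm{ce}}e'$ iff $W_e=W_{e'}$. Fix a computable bijective pairing function $\langle\cdot,\cdot\rangle:\omega^2\to\omega$, and let $W_e^{[k]}=\{i\in\omega:\langle k,i\rangle\in W_e\}$ be the $k$-th column of $W_e$. Define the following equivalence relations on $\omega$ (all extend $=^{\mathrm{ce}}$): - $e\mathrel{E^{\mathrm{ce}}_1}e'$ iff $W_e^{[k]}=W_{e'}^{[k]}$ for all but finitely many $k$; - $e\mathrel{E^{\mathrm{ce}}_3}e'$ iff for every $k$ the symmetric difference $W_e^{[k]}\mathbin{\triangle}W_{e'}^{[k]}$ is finite; - $e\mathrel{E^{\mathrm{ce}}_{\mathrm{set}}}e'$ iff $\{W_e^{[k]}:k\in\omega\}=\{W_{e'}^{[k]}:k\in\omega\}$; - $e\mathrel{E^{\mathrm{ce}}_{\max}}e'$ iff $W_e=W_{e'}=\emptyset$, or $W_e$ and $W_{e'}$ are both infinite, or $W_e,W_{e'}$ are both finite nonempty and $\max W_e=\max W_{e'}$. An enumeration of a set $A$ is a surjection $\mu:\omega\to A$; $\mu[s]$ denotes the finite string $\mu(0),\dots,\mu(s-1)$. A learner is an arbitrary function $\mathbf{M}:\omega^{<\omega}\to\omega$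 (no effectivity is assumed). For an equivalence relation $E^{\mathrm{ce}}$ on $\omega$ extending $=^{\mathrm{ce}}$, a family $\mathfrak{K}$ of nonempty c.e. sets is $E^{\mathrm{ce}}$-learnable if there is a learner $\mathbf{M}$ such that for every $e$ with $W_e\in\mathfrak{K}$ and every enumeration $\mu$ of $W_e$ there is $i\in\omega$ with $i\mathrel{E^{\mathrm{ce}}}e$ and $\mathbf{M}(\mu[s])=i$ for all sufficiently large $s$. $E^{\mathrm{ce}}\leq_{\mathrm{Learn}}F^{\mathrm{ce}}$ means that every $E^{\mathrm{ce}}$-learnable family of nonempty c.e. sets is also $F^{\mathrm{ce}}$-learnable; two relations are incomparable if neither is $\leq_{\mathrm{Learn}}$ the other. *)

theory Defs
  imports Complex_Main
begin

definition minimization :: "(nat \<Rightarrow> nat option) \<Rightarrow> nat option" where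
  "minimization h =
     (let P = (\<lambda>m. h m = Some 0 \<and> (\<forall>j<m. \<exists>y. h j = Some (Suc y)))
      in if \<exists>m. P m then Some (THE m. P m) else None)"

text \<open>
  Kleene's inductive characterisation. An \<open>n\<close>-ary partial function is represented on
  argument lists; only its values on lists of length \<open>n\<close> are meaningful, and \<open>ext\<close> makes the
  predicate independent of the values elsewhere. \<open>None\<close> means divergence.
\<close>

inductive partial_computable :: "nat \<Rightarrow> (nat list \<Rightarrow> nat option) \<Rightarrow> bool" where
  zero: "partial_computable n (\<lambda>xs. Some 0)"
| succ: "partial_computable 1 (\<lambda>xs. Some (Suc (xs ! 0)))"
| proj: "i < n \<Longrightarrow> partial_computable n (\<lambda>xs. Some (xs ! i))"
| comp: "partial_computable (length gs) f \<Longrightarrow> (\<forall>g\<in>set gs. partial_computable n g) \<Longrightarrow>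
    partial_computable n (\<lambda>xs. Option.bind (those (map (\<lambda>g. g xs) gs)) f)"
| prec: "partial_computable n f \<Longrightarrow> partial_computable (Suc (Suc n)) g \<Longrightarrow>
    partial_computable (Suc n)
      (\<lambda>xs. rec_nat (f (tl xs)) (\<lambda>m r. Option.bind r (\<lambda>y. g (m # y # tl xs))) (hd xs))"
| mu: "partial_computable (Suc n) f \<Longrightarrow>
    partial_computable n (\<lambda>xs. minimization (\<lambda>m. f (m # xs)))"
| ext: "partial_computable n f \<Longrightarrow> (\<forall>xs. length xs = n \<longrightarrow> g xs = f xs) \<Longrightarrow>
    partial_computable n g"

text \<open>
  Acceptability in the sense of Rogers: the universal function is partial computable and the
  s-m-n property holds.
\<close>

definition acceptable_enumeration :: "(nat \<Rightarrow> nat \<Rightarrow> nat option) \<Rightarrow> bool" where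
  "acceptable_enumeration \<phi> \<longleftrightarrow>
     range \<phi> = {f. partial_computable 1 (\<lambda>xs. f (xs ! 0))} \<and>
     partial_computable 2 (\<lambda>xs. \<phi> (xs ! 0) (xs ! 1)) \<and>
     (\<forall>g. partial_computable 2 (\<lambda>xs. g (xs ! 0) (xs ! 1)) \<longrightarrow>
        (\<exists>s. partial_computable 1 (\<lambda>xs. Some (s (xs ! 0))) \<and> (\<forall>x y. \<phi> (s x) y = g x y)))"

definition computable_pairing :: "(nat \<Rightarrow> nat \<Rightarrow> nat) \<Rightarrow> bool" where
  "computable_pairing pair \<longleftrightarrow>
     bij (\<lambda>(k, i). pair k i) \<and> partial_computable 2 (\<lambda>xs. Some (pair (xs ! 0) (xs ! 1)))"

definition W :: "(nat \<Rightarrow> nat \<Rightarrow> nat option) \<Rightarrow> nat \<Rightarrow> nat set" where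
  "W \<phi> e = dom (\<phi> e)"

definition column :: "(nat \<Rightarrow> nat \<Rightarrow> nat) \<Rightarrow> nat set \<Rightarrow> nat \<Rightarrow> nat set" where
  "column pair A k = {i. pair k i \<in> A}"

definition E1_ce :: "(nat \<Rightarrow> nat \<Rightarrow> nat option) \<Rightarrow> (nat \<Rightarrow> nat \<Rightarrow> nat) \<Rightarrow> nat \<Rightarrow> nat \<Rightarrow> bool" where
  "E1_ce \<phi> pair e e' \<longleftrightarrow> finite {k. column pair (W \<phi> e) k \<noteq> column pair (W \<phi> e') k}"

definition E3_ce :: "(nat \<Rightarrow> nat \<Rightarrow> nat option) \<Rightarrow> (nat \<Rightarrow> nat \<Rightarrow> nat) \<Rightarrow> nat \<Rightarrow> nat \<Rightarrow> bool" where
  "E3_ce \<phi> pair e e' \<longleftrightarrow>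
     (\<forall>k. finite ((column pair (W \<phi> e) k - column pair (W \<phi> e') k) \<union>
                  (column pair (W \<phi> e') k - column pair (W \<phi> e) k)))"

definition Eset_ce :: "(nat \<Rightarrow> nat \<Rightarrow> nat option) \<Rightarrow> (nat \<Rightarrow> nat \<Rightarrow> nat) \<Rightarrow> nat \<Rightarrow> nat \<Rightarrow> bool" where
  "Eset_ce \<phi> pair e e' \<longleftrightarrow> range (column pair (W \<phi> e)) = range (column pair (W \<phi> e'))"

definition Emax_ce :: "(nat \<Rightarrow> nat \<Rightarrow> nat option) \<Rightarrow> nat \<Rightarrow> nat \<Rightarrow> bool" where
  "Emax_ce \<phi> e e' \<longleftrightarrow>
     (W \<phi> e = {} \<and> W \<phi> e' = {}) \<or>
     (infinite (W \<phi> e) \<and> infinite (W \<phi> e')) \<or>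
     (finite (W \<phi> e) \<and> W \<phi> e \<noteq> {} \<and> finite (W \<phi> e') \<and> W \<phi> e' \<noteq> {} \<and>
        Max (W \<phi> e) = Max (W \<phi> e'))"

definition nonempty_ce_family :: "(nat \<Rightarrow> nat \<Rightarrow> nat option) \<Rightarrow> nat set set \<Rightarrow> bool" where
  "nonempty_ce_family \<phi> K \<longleftrightarrow> K \<subseteq> range (W \<phi>) \<and> {} \<notin> K"

definition learnable ::
  "(nat \<Rightarrow> nat \<Rightarrow> nat option) \<Rightarrow> (nat \<Rightarrow> nat \<Rightarrow> bool) \<Rightarrow> nat set set \<Rightarrow> bool" where
  "learnable \<phi> E K \<longleftrightarrow>
     (\<exists>M :: nat list \<Rightarrow> nat. \<forall>e. W \<phi> e \<in> K \<longrightarrow>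
        (\<forall>\<mu> :: nat \<Rightarrow> nat. range \<mu> = W \<phi> e \<longrightarrow>
           (\<exists>i. E i e \<and> (\<forall>\<^sub>F s in sequentially. M (map \<mu> [0..<s]) = i))))"

definition learn_reducible ::
  "(nat \<Rightarrow> nat \<Rightarrow> nat option) \<Rightarrow> (nat \<Rightarrow> nat \<Rightarrow> bool) \<Rightarrow> (nat \<Rightarrow> nat \<Rightarrow> bool) \<Rightarrow> bool" where
  "learn_reducible \<phi> E F \<longleftrightarrow>
     (\<forall>K. nonempty_ce_family \<phi> K \<longrightarrow> learnable \<phi> E K \<longrightarrow> learnable \<phi> F K)"

definition learn_incomparable ::
  "(nat \<Rightarrow> nat \<Rightarrow> nat option) \<Rightarrow> (nat \<Rightarrow> nat \<Rightarrow> bool) \<Rightarrow> (nat \<Rightarrow> nat \<Rightarrow> bool) \<Rightarrow> bool" where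
  "learn_incomparable \<phi> E F \<longleftrightarrow> \<not> learn_reducible \<phi> E F \<and> \<not> learn_reducible \<phi> F E"

end

theory Submission
  imports Defs "HOL-Library.Countable_Set"
begin

text \<open>
  A learner that succeeds on \<open>A\<close> has a locking sequence: a finite string over \<open>A\<close> after which no
  further string over \<open>A\<close> changes its conjecture. If \<open>A\<close> is the union of an increasing
  sequence \<open>B n\<close>, then this string is already a string over some \<open>B n\<close>, so the learner cannot
  tell \<open>A\<close> from \<open>B n\<close>. Hence \<open>{A} \<union> {B n | n}\<close> is not \<open>F\<close>-learnable when no \<open>B n\<close> is
  \<open>F\<close>-equivalent to \<open>A\<close>, while it is trivially \<open>E\<close>-learnable, by a constant learner, when all
  its members are \<open>E\<close>-equivalent. Each non-reduction is witnessed by such a chain of c.e. sets.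
\<close>

section \<open>Computable functions and decidable predicates\<close>

definition computable :: "nat \<Rightarrow> (nat list \<Rightarrow> nat) \<Rightarrow> bool" where
  "computable n f \<longleftrightarrow> partial_computable n (\<lambda>xs. Some (f xs))"

lemma computable_cong:
  assumes "computable n f" "\<And>xs. length xs = n \<Longrightarrow> g xs = f xs"
  shows "computable n g"
  using assms(1) unfolding computable_def by (rule partial_computable.ext) (simp add: assms(2))

lemma computable_nth: "i < n \<Longrightarrow> computable n (\<lambda>xs. xs ! i)"
  unfolding computable_def by (rule partial_computable.proj)

lemma those_map_Some: "those (map (\<lambda>g. Some (g xs)) gs) = Some (map (\<lambda>g. g xs) gs)"
  by (induction gs) auto

lemma computable_comp:
  assumes "computable (length gs) f" "\<And>g. g \<in> set gs \<Longrightarrow> computable n g"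
  shows "computable n (\<lambda>xs. f (map (\<lambda>g. g xs) gs))"
proof -
  let ?gs = "map (\<lambda>g xs. Some (g xs)) gs"
  have "partial_computable n (\<lambda>xs. Option.bind (those (map (\<lambda>g. g xs) ?gs)) (\<lambda>xs. Some (f xs)))"
    using assms by (intro partial_computable.comp) (auto simp: computable_def)
  then show ?thesis
    by (simp add: computable_def comp_def those_map_Some)
qed

lemma computable_comp1:
  assumes "computable 1 (\<lambda>xs. h (xs ! 0))" "computable n f"
  shows "computable n (\<lambda>xs. h (f xs))"
  using computable_comp[of "[f]" "\<lambda>xs. h (xs ! 0)" n] assms by simp

lemma computable_comp2:
  assumes "computable 2 (\<lambda>xs. h (xs ! 0) (xs ! 1))" "computable n f" "computable n g"
  shows "computable n (\<lambda>xs. h (f xs) (g xs))"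
  using computable_comp[of "[f, g]" "\<lambda>xs. h (xs ! 0) (xs ! 1)" n] assms
  by (auto simp: numeral_2_eq_2)

lemma computable_comp3:
  assumes "computable 3 (\<lambda>xs. h (xs ! 0) (xs ! 1) (xs ! 2))"
    "computable n f" "computable n g" "computable n k"
  shows "computable n (\<lambda>xs. h (f xs) (g xs) (k xs))"
  using computable_comp[of "[f, g, k]" "\<lambda>xs. h (xs ! 0) (xs ! 1) (xs ! 2)" n] assms
  by (auto simp: numeral_3_eq_3)

lemma computable_Suc: "computable n f \<Longrightarrow> computable n (\<lambda>xs. Suc (f xs))"
  using computable_comp1[of Suc] partial_computable.succ by (simp add: computable_def)

lemma computable_const: "computable n (\<lambda>xs. c)"
proof (induction c)
  case 0
  then show ?case unfolding computable_def by (rule partial_computable.zero)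
qed (rule computable_Suc)

lemma computable_rec_nat:
  assumes "computable n f" "computable (Suc (Suc n)) g"
  shows "computable (Suc n) (\<lambda>xs. rec_nat (f (tl xs)) (\<lambda>m y. g (m # y # tl xs)) (hd xs))"
proof -
  \<comment> \<open>With a total base and a total step the option-valued recursion never leaves
    \<open>Some\<close>, so it collapses to the ordinary one.\<close>
  have eq: "rec_nat (Some a) (\<lambda>m r. Option.bind r (\<lambda>y. Some (h m y))) k = Some (rec_nat a h k)"
    for a :: nat and h k
    by (induction k) auto
  show ?thesis
    using partial_computable.prec[OF assms[unfolded computable_def]]
    by (simp add: computable_def eq)
qed

lemma hd_nth_tl: "length xs = Suc n \<Longrightarrow> hd xs = xs ! 0 \<and> (\<forall>i<n. tl xs ! i = xs ! Suc i)"
  by (cases xs) auto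

lemma computable_rec_nat2:
  assumes "computable 1 (\<lambda>xs. f (xs ! 0))"
    and "computable 3 (\<lambda>xs. g (xs ! 0) (xs ! 1) (xs ! 2))"
    and "\<And>a b. rec_nat (f b) (\<lambda>m y. g m y b) a = h a b"
  shows "computable 2 (\<lambda>xs. h (xs ! 0) (xs ! 1))"
proof -
  from computable_rec_nat[OF assms(1), of "\<lambda>xs. g (xs ! 0) (xs ! 1) (xs ! 2)"] assms(2)
  have "computable 2 (\<lambda>xs. h (hd xs) (tl xs ! 0))"
    by (simp add: assms(3) numeral_2_eq_2 numeral_3_eq_3)
  then show ?thesis
    by (rule computable_cong) (simp add: hd_nth_tl)
qed

lemma computable_add:
  assumes "computable n f" "computable n g"
  shows "computable n (\<lambda>xs. f xs + g xs)"
proof (rule computable_comp2[OF _ assms])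
  have "rec_nat b (\<lambda>m y. Suc y) a = a + b" for a b :: nat
    by (induction a) auto
  then show "computable 2 (\<lambda>xs. xs ! 0 + xs ! 1)"
    by (intro computable_rec_nat2[of "\<lambda>b. b" "\<lambda>m y b. Suc y"] computable_Suc computable_nth) auto
qed

lemma computable_mult:
  assumes "computable n f" "computable n g"
  shows "computable n (\<lambda>xs. f xs * g xs)"
proof (rule computable_comp2[OF _ assms])
  have "rec_nat 0 (\<lambda>m y. y + b) a = a * b" for a b :: nat
    by (induction a) auto
  then show "computable 2 (\<lambda>xs. xs ! 0 * xs ! 1)"
    by (intro computable_rec_nat2[of "\<lambda>b. 0" "\<lambda>m y b. y + b"] computable_const computable_add
        computable_nth) auto
qed

lemma computable_diff:
  assumes "computable n f" "computable n g"
  shows "computable n (\<lambda>xs. f xs - g xs)"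
proof -
  have "rec_nat 0 (\<lambda>m y. m) a = a - 1" for a :: nat
    by (induction a) auto
  then have "computable 2 (\<lambda>xs. xs ! 0 - 1)"
    by (intro computable_rec_nat2[of "\<lambda>b. 0" "\<lambda>m y b. m" "\<lambda>a b. a - 1"] computable_const
        computable_nth) auto
  from computable_comp2[where h = "\<lambda>a b. a - 1", OF this]
  have pred: "computable n (\<lambda>xs. f xs - 1)" if "computable n f" for n f
    using that by blast
  \<comment> \<open>Subtraction iterates the predecessor, so the recursion runs on the subtrahend;
    that argument comes first here and the two are swapped back at the end.\<close>
  have "rec_nat b (\<lambda>m y. y - 1) a = b - a" for a b :: nat
    by (induction a) auto
  then have "computable 2 (\<lambda>xs. xs ! 1 - xs ! 0)"
    by (intro computable_rec_nat2[of "\<lambda>b. b" "\<lambda>m y b. y - 1" "\<lambda>a b. b - a"] pred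
        computable_nth) auto
  from computable_comp2[where h = "\<lambda>a b. b - a", OF this assms(2,1)] show ?thesis .
qed

text \<open>A product of naturals vanishes exactly when some factor does, so this is bounded
  existential quantification over zero tests. The bound is an argument separate from those of
  \<open>h\<close>; \<open>ce_coded\<close> later makes it depend on one of them.\<close>

lemma computable_prod:
  assumes "computable 3 (\<lambda>xs. h (xs ! 0) (xs ! 1) (xs ! 2))"
  shows "computable 3 (\<lambda>xs. \<Prod>k<xs ! 0. h k (xs ! 1) (xs ! 2))"
proof -
  have eq: "rec_nat 1 (\<lambda>k y. y * f k) j = (\<Prod>k<j. f k)" for f :: "nat \<Rightarrow> nat" and j
    by (induction j) auto
  have "computable (Suc (Suc 2)) (\<lambda>xs. xs ! 1 * h (xs ! 0) (xs ! 2) (xs ! 3))"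
    by (intro computable_mult computable_comp3[OF assms] computable_nth) auto
  from computable_rec_nat[OF computable_const[of _ 1] this]
  have "computable 3 (\<lambda>xs. \<Prod>k<hd xs. h k (tl xs ! 0) (tl xs ! 1))"
    by (simp add: eq[unfolded One_nat_def] numeral_3_eq_3 numeral_2_eq_2)
  then show ?thesis
    by (rule computable_cong) (simp add: hd_nth_tl numeral_3_eq_3 numeral_2_eq_2)
qed

text \<open>Zero stands for truth, so that disjunction becomes a product and a search for a zero
  becomes a search for a witness.\<close>

definition decidable :: "nat \<Rightarrow> (nat list \<Rightarrow> bool) \<Rightarrow> bool" where
  "decidable n P \<longleftrightarrow> computable n (\<lambda>xs. if P xs then 0 else 1)"

lemma decidable_le:
  assumes "computable n f" "computable n g"
  shows "decidable n (\<lambda>xs. f xs \<le> g xs)"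
proof -
  \<comment> \<open>Truncated subtraction makes \<open>f xs - g xs\<close> zero iff
    \<open>f xs \<le> g xs\<close>, and \<open>1 - (1 - d)\<close> cuts any positive
    \<open>d\<close> down to 1.\<close>
  have "computable n (\<lambda>xs. 1 - (1 - (f xs - g xs)))"
    by (intro computable_diff computable_const assms)
  then show ?thesis
    unfolding decidable_def by (rule computable_cong) auto
qed

lemma decidable_less:
  "computable n f \<Longrightarrow> computable n g \<Longrightarrow> decidable n (\<lambda>xs. f xs < g xs)"
  using decidable_le[of n "\<lambda>xs. Suc (f xs)" g] by (simp add: Suc_le_eq computable_Suc)

lemma decidable_disj:
  assumes "decidable n P" "decidable n Q"
  shows "decidable n (\<lambda>xs. P xs \<or> Q xs)"
  using computable_mult[OF assms[unfolded decidable_def]]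
  unfolding decidable_def by (rule computable_cong) auto

lemma decidable_conj:
  assumes "decidable n P" "decidable n Q"
  shows "decidable n (\<lambda>xs. P xs \<and> Q xs)"
proof -
  have "computable n (\<lambda>xs. 1 - (1 - ((if P xs then 0 else 1) + (if Q xs then 0 else 1))))"
    using assms unfolding decidable_def by (intro computable_diff computable_add computable_const)
  then show ?thesis
    unfolding decidable_def by (rule computable_cong) auto
qed

lemma decidable_eq:
  assumes "computable n f" "computable n g"
  shows "decidable n (\<lambda>xs. f xs = g xs)"
  using decidable_conj[OF decidable_le[OF assms] decidable_le[OF assms(2,1)]]
  unfolding decidable_def by (rule computable_cong) auto

lemma decidable_True: "decidable n (\<lambda>xs. True)"
  using decidable_le[OF computable_const[of n 0] computable_const[of n 0]] by simp

lemmas decidable_intros =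
  decidable_le decidable_less decidable_eq decidable_conj decidable_disj decidable_True
  computable_const computable_nth

text \<open>For a total function the condition on earlier values singles out the least zero, which
  exists as soon as some zero does.\<close>

lemma minimization_total_eq_None: "minimization (\<lambda>m. Some (f m)) = None \<longleftrightarrow> (\<forall>m. f m \<noteq> 0)"
proof -
  have Suc: "(\<exists>y. a = Suc y) \<longleftrightarrow> a \<noteq> 0" for a :: nat
    by (cases a) auto
  have "(\<exists>m. f m = 0 \<and> (\<forall>j<m. f j \<noteq> 0)) \<longleftrightarrow> (\<exists>m. f m = 0)"
    by (rule exists_least_iff[symmetric])
  then show ?thesis
    by (simp add: minimization_def Suc)
qed

section \<open>Locking sequences\<close>

text \<open>Otherwise every string over \<open>A\<close> can be extended within \<open>A\<close> so
  as to change the conjecture. Interleaving such extensions with a listing of \<open>A\<close>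
  yields an enumeration of \<open>A\<close> on which \<open>M\<close> never settles.\<close>

lemma locking_sequence:
  fixes M :: "'a list \<Rightarrow> 'b" and A :: "'a set"
  assumes "countable A" "A \<noteq> {}"
    and conv: "\<And>\<mu> :: nat \<Rightarrow> 'a. range \<mu> = A \<Longrightarrow> \<exists>i. \<forall>\<^sub>F s in sequentially. M (map \<mu> [0..<s]) = i"
  shows "\<exists>\<sigma>. set \<sigma> \<subseteq> A \<and> (\<forall>\<tau>. set \<tau> \<subseteq> A \<longrightarrow> M (\<sigma> @ \<tau>) = M \<sigma>)"
proof (rule ccontr)
  assume no_lock: "\<not> ?thesis"
  define a where "a = from_nat_into A"
  have a: "range a = A"
    using assms(1,2) by (simp add: a_def range_from_nat_into)
  have "\<exists>\<tau>. set \<tau> \<subseteq> A \<and> M (\<sigma> @ \<tau>) \<noteq> M \<sigma>" if "set \<sigma> \<subseteq> A" for \<sigma>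
    using that no_lock by blast
  then obtain T where T: "\<And>\<sigma>. set \<sigma> \<subseteq> A \<Longrightarrow> set (T \<sigma>) \<subseteq> A \<and> M (\<sigma> @ T \<sigma>) \<noteq> M \<sigma>"
    by metis
  \<comment> \<open>Each stage first appends \<open>a n\<close>, so that all of \<open>A\<close> is
    eventually listed, and then an extension forcing a change of conjecture.\<close>
  define S where "S = rec_nat [] (\<lambda>n \<sigma>. (\<sigma> @ [a n]) @ T (\<sigma> @ [a n]))"
  have S_Suc: "S (Suc n) = (S n @ [a n]) @ T (S n @ [a n])" for n
    by (simp add: S_def)
  have S_sub: "set (S n) \<subseteq> A" for n
  proof (induction n)
    case (Suc n)
    then have "set (S n @ [a n]) \<subseteq> A" using a by auto
    with T[OF this] show ?case by (simp only: S_Suc set_append) blast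
  qed (simp add: S_def)
  have S_prefix: "\<exists>\<tau>. S (n + m) = S n @ \<tau>" for n m
    by (induction m) (auto simp: S_Suc)
  have len: "n \<le> length (S n)" for n
    by (induction n) (auto simp: S_Suc)
  \<comment> \<open>The stages extend one another and stage \<open>Suc j\<close> has length at least
    \<open>Suc j\<close>, so position \<open>j\<close> is already fixed there.\<close>
  define \<mu> where "\<mu> j = S (Suc j) ! j" for j
  have \<mu>: "\<mu> j = S n ! j" if "j < length (S n)" for j n
  proof (cases "n \<le> Suc j")
    case True
    then obtain m where "Suc j = n + m" by (auto dest: le_Suc_ex)
    with S_prefix[of n m] that show ?thesis by (auto simp: \<mu>_def nth_append)
  next
    case False
    then obtain m where "n = Suc j + m" by (metis le_Suc_ex nat_le_linear)
    with S_prefix[of "Suc j" m] len[of "Suc j"] show ?thesis by (auto simp: \<mu>_def nth_append)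
  qed
  have map_S: "map \<mu> [0..<length (S n)] = S n" for n
    by (rule nth_equalityI) (auto simp: \<mu>)
  have map_Sa: "map \<mu> [0..<length (S n @ [a n])] = S n @ [a n]" for n
  proof -
    have "\<mu> (length (S n)) = S (Suc n) ! length (S n)"
      by (rule \<mu>) (simp add: S_Suc)
    also have "\<dots> = a n" by (simp add: S_Suc)
    finally show ?thesis using map_S[of n] by simp
  qed
  have "\<mu> j \<in> A" for j
  proof -
    have "\<mu> j \<in> set (S (Suc j))"
      unfolding \<mu>_def using len[of "Suc j"] by (intro nth_mem) simp
    with S_sub show ?thesis by blast
  qed
  moreover have "a n \<in> range \<mu>" for n
  proof -
    have "a n \<in> set (map \<mu> [0..<length (S n @ [a n])])" by (simp only: map_Sa) simp
    then show ?thesis by auto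
  qed
  ultimately have "range \<mu> = A" using a by auto
  from conv[OF this] obtain i N where N: "\<And>s. s \<ge> N \<Longrightarrow> M (map \<mu> [0..<s]) = i"
    by (auto simp: eventually_sequentially)
  \<comment> \<open>\<open>S N @ [a N]\<close> and \<open>S (Suc N)\<close> are both initial
    segments of \<open>\<mu>\<close> of length at least \<open>N\<close>, so \<open>M\<close> takes
    the limit value on both, although \<open>T\<close> was chosen to make these values
    differ.\<close>
  have "N \<le> length (S N)" by (rule len)
  then have "M (S N @ [a N]) = i"
    using N[of "length (S N @ [a N])"] unfolding map_Sa by simp
  moreover have "length (S (Suc N)) \<ge> N" using len[of "Suc N"] by simp
  then have "M (S (Suc N)) = i"
    using N[of "length (S (Suc N))"] unfolding map_S by simp
  moreover have "set (S N @ [a N]) \<subseteq> A" using S_sub a by auto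
  ultimately show False
    using T[of "S N @ [a N]"] unfolding S_Suc by metis
qed

text \<open>Some enumeration of \<open>C\<close> starts with \<open>\<sigma>\<close>, and from there
  on the conjecture stays \<open>M \<sigma>\<close>, which is therefore the limit. Applied to both
  \<open>A\<close> and \<open>B n\<close>, this makes one index correct for both.\<close>

lemma learner_locked_limit:
  assumes "countable C" "C \<noteq> {}" "set \<sigma> \<subseteq> C"
    and lock: "\<And>\<tau>. set \<tau> \<subseteq> C \<Longrightarrow> M (\<sigma> @ \<tau>) = M \<sigma>"
    and conv: "\<And>\<mu> :: nat \<Rightarrow> 'a. range \<mu> = C \<Longrightarrow>
      \<exists>i. P i \<and> (\<forall>\<^sub>F s in sequentially. M (map \<mu> [0..<s]) = i)"
  shows "P (M \<sigma>)"
proof -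
  define c where "c = from_nat_into C"
  have c: "range c = C"
    using assms(1,2) by (simp add: c_def range_from_nat_into)
  define \<mu> where "\<mu> j = (if j < length \<sigma> then \<sigma> ! j else c (j - length \<sigma>))" for j
  have map_\<mu>: "map \<mu> [0..<length \<sigma> + m] = \<sigma> @ map c [0..<m]" for m
    by (rule nth_equalityI) (auto simp: \<mu>_def nth_append)
  have "c m = \<mu> (length \<sigma> + m)" for m by (simp add: \<mu>_def)
  then have "C \<subseteq> range \<mu>" using c by auto
  moreover have "\<mu> j \<in> C" for j
    using assms(3) c by (auto simp: \<mu>_def)
  ultimately have "range \<mu> = C" by auto
  from conv[OF this] obtain i N where i: "P i" "\<And>s. s \<ge> N \<Longrightarrow> M (map \<mu> [0..<s]) = i"
    by (auto simp: eventually_sequentially)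
  have "M (\<sigma> @ map c [0..<N]) = i"
    using i(2)[of "length \<sigma> + N"] unfolding map_\<mu> by simp
  moreover have "M (\<sigma> @ map c [0..<N]) = M \<sigma>"
    using c by (intro lock) auto
  ultimately show ?thesis using i(1) by simp
qed

lemma not_learn_reducibleI:
  fixes B :: "nat \<Rightarrow> nat set"
  assumes "equivp E" "equivp F"
    and ce: "A \<in> range (W \<phi>)" "\<And>n. B n \<in> range (W \<phi>)"
    and chain: "incseq B" "A = (\<Union>n. B n)" "B 0 \<noteq> {}"
    and E: "\<And>i j n. W \<phi> i = A \<Longrightarrow> W \<phi> j = B n \<Longrightarrow> E i j"
    and F: "\<And>i j n. W \<phi> i = A \<Longrightarrow> W \<phi> j = B n \<Longrightarrow> \<not> F i j"
  shows "\<not> learn_reducible \<phi> E F"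
proof
  assume red: "learn_reducible \<phi> E F"
  define K where "K = insert A (range B)"
  obtain a where a: "W \<phi> a = A" using ce(1) by auto
  have "\<forall>n. \<exists>e. W \<phi> e = B n" using ce(2) by (metis rangeE)
  then obtain b where b: "\<And>n. W \<phi> (b n) = B n" by metis
  have B_ne: "B n \<noteq> {}" for n
    using incseqD[OF chain(1), of 0 n] chain(3) by auto
  then have A_ne: "A \<noteq> {}" using chain(2) by auto
  have "nonempty_ce_family \<phi> K"
    using ce B_ne A_ne by (auto simp: nonempty_ce_family_def K_def)
  moreover have "E a e" if "W \<phi> e \<in> K" for e
  proof (cases "W \<phi> e = A")
    case True
    \<comment> \<open>The hypothesis relates indices of \<open>A\<close> only to indices of some
      \<open>B n\<close>, so two indices of \<open>A\<close> are compared through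
      \<open>b 0\<close>.\<close>
    have "E a (b 0)" "E e (b 0)" using E a b True by auto
    then show ?thesis using \<open>equivp E\<close> by (meson equivp_symp equivp_transp)
  next
    case False
    then show ?thesis using that E a by (auto simp: K_def)
  qed
  then have "learnable \<phi> E K"
    unfolding learnable_def by (intro exI[of _ "\<lambda>_. a"]) auto
  ultimately have "learnable \<phi> F K"
    using red by (simp add: learn_reducible_def)
  then obtain M :: "nat list \<Rightarrow> nat" where
    M: "\<And>e \<mu>. W \<phi> e \<in> K \<Longrightarrow> range \<mu> = W \<phi> e \<Longrightarrow>
          \<exists>i. F i e \<and> (\<forall>\<^sub>F s in sequentially. M (map \<mu> [0..<s]) = i)"
    unfolding learnable_def by metis
  have Ma: "\<exists>i. F i a \<and> (\<forall>\<^sub>F s in sequentially. M (map \<mu> [0..<s]) = i)" if "range \<mu> = A" for \<mu>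
    using M[of a \<mu>] a that by (simp add: K_def)
  have Mb: "\<exists>i. F i (b n) \<and> (\<forall>\<^sub>F s in sequentially. M (map \<mu> [0..<s]) = i)"
    if "range \<mu> = B n" for \<mu> n
    using M[of "b n" \<mu>] b that by (simp add: K_def)
  obtain \<sigma> where \<sigma>: "set \<sigma> \<subseteq> A" "\<And>\<tau>. set \<tau> \<subseteq> A \<Longrightarrow> M (\<sigma> @ \<tau>) = M \<sigma>"
    using locking_sequence[of A M] A_ne Ma by blast
  \<comment> \<open>A finite set covered by a chain lies inside one member; this places the locking
    string over some \<open>B n\<close>.\<close>
  have "subset.chain UNIV (range B)"
    using chain(1) by (auto simp: subset_chain_def) (meson incseqD nat_le_linear subsetD)
  moreover have "set \<sigma> \<subseteq> (\<Union>n. B n)"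
    using \<sigma>(1) chain(2) by simp
  ultimately obtain n where n: "set \<sigma> \<subseteq> B n"
    using finite_subset_Union_chain[of "set \<sigma>" "range B" UNIV thesis] by auto
  have "B n \<subseteq> A" using chain(2) by auto
  have "F (M \<sigma>) a"
    by (rule learner_locked_limit[of A \<sigma> M "\<lambda>i. F i a"]) (use \<sigma> A_ne Ma in auto)
  moreover have "F (M \<sigma>) (b n)"
    by (rule learner_locked_limit[of "B n" \<sigma> M "\<lambda>i. F i (b n)"])
      (use \<sigma> n \<open>B n \<subseteq> A\<close> B_ne Mb in auto)
  ultimately have "F a (b n)"
    using \<open>equivp F\<close> by (meson equivp_symp equivp_transp)
  then show False using F a b by blast
qed

lemma equivp_E1_ce: "equivp (E1_ce \<phi> pair)"
proof (rule equivpI)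
  show "transp (E1_ce \<phi> pair)"
    unfolding transp_def E1_ce_def
  proof (intro allI impI)
    fix x y z
    let ?D = "\<lambda>x y. {k. column pair (W \<phi> x) k \<noteq> column pair (W \<phi> y) k}"
    assume "finite (?D x y)" "finite (?D y z)"
    moreover have "?D x z \<subseteq> ?D x y \<union> ?D y z" by auto
    ultimately show "finite (?D x z)" by (meson finite_UnI finite_subset)
  qed
qed (auto simp: reflp_def symp_def E1_ce_def eq_commute)

lemma equivp_E3_ce: "equivp (E3_ce \<phi> pair)"
proof (rule equivpI)
  show "transp (E3_ce \<phi> pair)"
    unfolding transp_def E3_ce_def
  proof (intro allI impI)
    fix x y z k
    let ?D = "\<lambda>x y. (column pair (W \<phi> x) k - column pair (W \<phi> y) k) \<union>
      (column pair (W \<phi> y) k - column pair (W \<phi> x) k)"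
    assume "\<forall>k. finite ((column pair (W \<phi> x) k - column pair (W \<phi> y) k) \<union>
        (column pair (W \<phi> y) k - column pair (W \<phi> x) k))"
      and "\<forall>k. finite ((column pair (W \<phi> y) k - column pair (W \<phi> z) k) \<union>
        (column pair (W \<phi> z) k - column pair (W \<phi> y) k))"
    then have "finite (?D x y \<union> ?D y z)" by blast
    then show "finite (?D x z)" by (rule rev_finite_subset) auto
  qed
qed (auto simp: reflp_def symp_def E3_ce_def)

lemma equivp_Eset_ce: "equivp (Eset_ce \<phi> pair)"
  by (intro equivpI) (auto simp: reflp_def symp_def transp_def Eset_ce_def)

lemma equivp_Emax_ce: "equivp (Emax_ce \<phi>)"
  by (intro equivpI) (auto simp: reflp_def symp_def transp_def Emax_ce_def)

lemmas equivp_intros = equivp_E1_ce equivp_E3_ce equivp_Eset_ce equivp_Emax_ce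

section \<open>The separating chains\<close>

definition coded :: "(nat \<Rightarrow> nat \<Rightarrow> nat) \<Rightarrow> (nat \<Rightarrow> nat \<Rightarrow> bool) \<Rightarrow> nat set" where
  "coded pair R = {pair k i | k i. R k i}"

locale enumerated =
  fixes \<phi> :: "nat \<Rightarrow> nat \<Rightarrow> nat option" and pair :: "nat \<Rightarrow> nat \<Rightarrow> nat"
  assumes enum: "acceptable_enumeration \<phi>" and pairing: "computable_pairing pair"
begin

lemma pair_eq: "pair k i = pair k' i' \<longleftrightarrow> k = k' \<and> i = i'"
proof -
  have "inj (\<lambda>(k, i). pair k i)"
    using pairing by (simp add: computable_pairing_def bij_is_inj)
  from inj_eq[OF this, of "(k, i)" "(k', i')"] show ?thesis by simp
qed

lemma column_coded: "column pair (coded pair R) k = {i. R k i}"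
  by (auto simp: column_def coded_def pair_eq)

lemma finite_coded: "finite (coded pair R) \<longleftrightarrow> finite {(k, i). R k i}"
proof -
  have "coded pair R = (\<lambda>(k, i). pair k i) ` {(k, i). R k i}"
    by (auto simp: coded_def)
  moreover have "inj_on (\<lambda>(k, i). pair k i) {(k, i). R k i}"
    by (auto simp: inj_on_def pair_eq)
  ultimately show ?thesis by (simp add: finite_image_iff)
qed

section \<open>Computable enumerability of coded sets\<close>

text \<open>The unbounded search for a zero of \<open>c\<close> at \<open>x\<close> halts exactly on
  this set, which is thus the domain of a partial computable function.\<close>

lemma ce_zero_set:
  assumes "computable 2 (\<lambda>xs. c (xs ! 0) (xs ! 1))"
  shows "{x. \<exists>m. c m x = 0} \<in> range (W \<phi>)"
proof -
  let ?f = "\<lambda>x. minimization (\<lambda>m. Some (c m x))"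
  have "partial_computable (Suc 1) (\<lambda>xs. Some (c (xs ! 0) (xs ! 1)))"
    using assms by (simp add: computable_def numeral_2_eq_2)
  from partial_computable.mu[OF this]
  have "partial_computable 1 (\<lambda>xs. ?f (xs ! 0))" by simp
  then have "?f \<in> range \<phi>"
    using enum by (simp add: acceptable_enumeration_def)
  then obtain e where "\<phi> e = ?f" by (metis rangeE)
  then have "W \<phi> e = {x. \<exists>m. c m x = 0}"
    by (simp add: W_def dom_def minimization_total_eq_None)
  then show ?thesis by blast
qed

text \<open>
  Membership of \<open>x\<close> is found by searching for the antidiagonal \<open>m = k + i\<close> of a pair with code \<open>x\<close>.
\<close>

lemma ce_coded:
  assumes "decidable 2 (\<lambda>xs. R (xs ! 0) (xs ! 1))"
  shows "coded pair R \<in> range (W \<phi>)"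
proof -
  define \<chi> where "\<chi> k i = (if R k i then 0 else 1 :: nat)" for k i
  \<comment> \<open>The two truncated differences add up to the distance between
    \<open>pair k (m - k)\<close> and \<open>x\<close>, so \<open>h\<close> vanishes iff
    \<open>x\<close> codes that pair and \<open>R\<close> holds of it.\<close>
  define h where "h k m x = (pair k (m - k) - x) + (x - pair k (m - k)) + \<chi> k (m - k)" for k m x
  have pair: "computable 2 (\<lambda>xs. pair (xs ! 0) (xs ! 1))"
    using pairing by (simp add: computable_pairing_def computable_def)
  have \<chi>: "computable 2 (\<lambda>xs. \<chi> (xs ! 0) (xs ! 1))"
    using assms by (simp add: decidable_def \<chi>_def)
  have "computable 3 (\<lambda>xs. h (xs ! 0) (xs ! 1) (xs ! 2))"
    unfolding h_def
    by (intro computable_add computable_diff computable_comp2[OF pair] computable_comp2[OF \<chi>]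
        computable_nth) auto
  from computable_prod[OF this]
  have "computable 2 (\<lambda>xs. \<Prod>k<Suc (xs ! 0). h k (xs ! 0) (xs ! 1))"
    by (rule computable_comp3[where h = "\<lambda>j m x. \<Prod>k<j. h k m x"])
      (auto intro!: computable_Suc computable_nth)
  from ce_zero_set[where c = "\<lambda>m x. \<Prod>k<Suc m. h k m x", OF this]
  have "{x. \<exists>m. (\<Prod>k<Suc m. h k m x) = 0} \<in> range (W \<phi>)" .
  moreover have "(\<exists>m. (\<Prod>k<Suc m. h k m x) = 0) \<longleftrightarrow> x \<in> coded pair R" for x
  proof
    assume "\<exists>m. (\<Prod>k<Suc m. h k m x) = 0"
    then obtain m k where "h k m x = 0" by (auto simp del: prod.lessThan_Suc)
    then have "x = pair k (m - k)" "R k (m - k)"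
      by (auto simp: h_def \<chi>_def split: if_splits)
    then show "x \<in> coded pair R" by (auto simp: coded_def)
  next
    assume "x \<in> coded pair R"
    then obtain k i where "x = pair k i" "R k i" by (auto simp: coded_def)
    then have "h k (k + i) x = 0" by (simp add: h_def \<chi>_def)
    then have "(\<Prod>k'<Suc (k + i). h k' (k + i) x) = 0"
      by (intro prod_zero bexI[of _ k]) auto
    then show "\<exists>m. (\<Prod>k<Suc m. h k m x) = 0" by blast
  qed
  ultimately show ?thesis by simp
qed

text \<open>The chain argument for sets given by decidable relations: enumerability is discharged
  once, and each separation reduces to comparing columns or finiteness.\<close>

lemma not_learn_reducible_coded:
  assumes "equivp E" "equivp F"
    and "decidable 2 (\<lambda>xs. R (xs ! 0) (xs ! 1))" "\<And>n. decidable 2 (\<lambda>xs. S n (xs ! 0) (xs ! 1))"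
    and "\<And>n k i. S n k i \<Longrightarrow> S (Suc n) k i" "\<And>k i. R k i \<longleftrightarrow> (\<exists>n. S n k i)" "\<exists>k i. S 0 k i"
    and "\<And>i j n. W \<phi> i = coded pair R \<Longrightarrow> W \<phi> j = coded pair (S n) \<Longrightarrow> E i j"
    and "\<And>i j n. W \<phi> i = coded pair R \<Longrightarrow> W \<phi> j = coded pair (S n) \<Longrightarrow> \<not> F i j"
  shows "\<not> learn_reducible \<phi> E F"
proof (rule not_learn_reducibleI[where A = "coded pair R" and B = "\<lambda>n. coded pair (S n)"])
  show "incseq (\<lambda>n. coded pair (S n))"
    using assms(5) unfolding coded_def by (intro incseq_SucI) blast
  show "coded pair R = (\<Union>n. coded pair (S n))" "coded pair (S 0) \<noteq> {}"
    using assms(6,7) by (auto simp: coded_def)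
  show "equivp E" "equivp F"
    by (fact assms)+
  show "coded pair R \<in> range (W \<phi>)" "coded pair (S n) \<in> range (W \<phi>)" for n
    by (intro ce_coded assms(3,4))+
qed (fact assms)+

section \<open>Verification of the chains, one relation at a time\<close>

lemma finite_coded_row:
  "finite (coded pair (\<lambda>k i. i = c \<and> P k)) \<longleftrightarrow> finite {k. P k}"
proof -
  have "{(k, i). i = c \<and> P k} = (\<lambda>k. (k, c)) ` {k. P k}" by auto
  then show ?thesis by (simp add: finite_coded finite_image_iff inj_on_def)
qed

lemma finite_coded_column:
  "finite (coded pair (\<lambda>k i. k = c \<and> P i)) \<longleftrightarrow> finite {i. P i}"
proof -
  have "{(k, i). k = c \<and> P i} = (\<lambda>i. (c, i)) ` {i. P i}" by auto
  then show ?thesis by (simp add: finite_coded finite_image_iff inj_on_def)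
qed

lemma infinite_coded_rows: "infinite (coded pair (\<lambda>k i. i \<le> n))"
proof
  assume "finite (coded pair (\<lambda>k i. i \<le> n))"
  then have "finite (coded pair (\<lambda>k i. i = 0))"
    by (rule rev_finite_subset) (auto simp: coded_def)
  then show False using finite_coded_row[of 0 "\<lambda>_. True"] by simp
qed

text \<open>All sets in the chain are infinite, hence equivalent for \<open>Emax_ce\<close>. But
  every column is full in the limit and \<open>{..n}\<close> in the approximation, which refutes the
  other three relations at once.\<close>

lemma Emax_not_learn_reducible:
  assumes "F \<in> {E1_ce \<phi> pair, E3_ce \<phi> pair, Eset_ce \<phi> pair}"
  shows "\<not> learn_reducible \<phi> (Emax_ce \<phi>) F"
proof (rule not_learn_reducible_coded[where R = "\<lambda>k i. True" and S = "\<lambda>n k i. i \<le> n"])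
  fix i j n
  assume W: "W \<phi> i = coded pair (\<lambda>k i. True)" "W \<phi> j = coded pair (\<lambda>k i. i \<le> n)"
  have "infinite (coded pair (\<lambda>k i. True))"
    using infinite_coded_rows[of 0] by (rule infinite_super[rotated]) (auto simp: coded_def)
  then show "Emax_ce \<phi> i j"
    by (simp add: Emax_ce_def W infinite_coded_rows)
  have "UNIV \<noteq> {i. i \<le> n}" "infinite (UNIV - {i. i \<le> n})"
    by (auto simp: set_eq_iff not_le)
  then have "\<not> E1_ce \<phi> pair i j" "\<not> E3_ce \<phi> pair i j" "\<not> Eset_ce \<phi> pair i j"
    by (simp_all add: E1_ce_def E3_ce_def Eset_ce_def W column_coded)
  then show "\<not> F i j" using assms by auto
next
  show "equivp F" using assms by (auto intro: equivp_intros)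
  show "decidable 2 (\<lambda>xs. True)" "decidable 2 (\<lambda>xs. xs ! 1 \<le> n)" for n
    by (intro decidable_intros; simp)+
qed (auto intro: equivp_intros)

text \<open>Only column 0 ever changes, so \<open>E1_ce\<close> holds. That column is full in the
  limit and finite in the approximation; the approximations are finite sets and the limit is
  infinite.\<close>

lemma E1_not_learn_reducible:
  assumes "F \<in> {E3_ce \<phi> pair, Eset_ce \<phi> pair, Emax_ce \<phi>}"
  shows "\<not> learn_reducible \<phi> (E1_ce \<phi> pair) F"
proof (rule not_learn_reducible_coded[where R = "\<lambda>k i. k = 0"
      and S = "\<lambda>n k i. k = 0 \<and> i \<le> n"])
  fix i j n
  assume W: "W \<phi> i = coded pair (\<lambda>k i. k = 0)"
    "W \<phi> j = coded pair (\<lambda>k i. k = 0 \<and> i \<le> n)"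
  have "{k :: nat. {i :: nat. k = 0} \<noteq> {i. k = 0 \<and> i \<le> n}} \<subseteq> {0}" by auto
  then have "finite {k :: nat. {i :: nat. k = 0} \<noteq> {i. k = 0 \<and> i \<le> n}}"
    by (rule finite_subset) simp
  then show "E1_ce \<phi> pair i j"
    by (simp add: E1_ce_def W column_coded)
  have "UNIV \<noteq> {i. i \<le> n}" "infinite (UNIV - {i. i \<le> n})"
    by (auto simp: set_eq_iff not_le)
  then have "\<not> E3_ce \<phi> pair i j" "\<not> Eset_ce \<phi> pair i j"
    by (auto simp: E3_ce_def Eset_ce_def W column_coded)
  moreover have "\<not> Emax_ce \<phi> i j"
    using finite_coded_column[of 0 "\<lambda>_. True"] finite_coded_column[of 0 "\<lambda>i. i \<le> n"]
    by (auto simp: Emax_ce_def W coded_def)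
  ultimately show "\<not> F i j" using assms by auto
next
  show "equivp F" using assms by (auto intro: equivp_intros)
  show "decidable 2 (\<lambda>xs. xs ! 0 = 0)" "decidable 2 (\<lambda>xs. xs ! 0 = 0 \<and> xs ! 1 \<le> n)" for n
    by (intro decidable_intros; simp)+
qed (auto intro: equivp_intros)

text \<open>Each column loses at most the element 0, so \<open>E3_ce\<close> holds. Yet infinitely
  many columns change, the empty column occurs only in the approximations, and these are finite
  while the limit is infinite.\<close>

lemma E3_not_learn_reducible:
  assumes "F \<in> {E1_ce \<phi> pair, Eset_ce \<phi> pair, Emax_ce \<phi>}"
  shows "\<not> learn_reducible \<phi> (E3_ce \<phi> pair) F"
proof (rule not_learn_reducible_coded[where R = "\<lambda>k i. i = 0"
      and S = "\<lambda>n k i. i = 0 \<and> k \<le> n"])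
  fix i j n
  assume W: "W \<phi> i = coded pair (\<lambda>k i. i = 0)"
    "W \<phi> j = coded pair (\<lambda>k i. i = 0 \<and> k \<le> n)"
  show "E3_ce \<phi> pair i j"
    by (simp add: E3_ce_def W column_coded)
  have "\<not> E1_ce \<phi> pair i j"
  proof -
    have "{n<..} \<subseteq> {k. {i :: nat. i = 0} \<noteq> {i. i = 0 \<and> k \<le> n}}"
      by (intro subsetI CollectI) simp
    from infinite_super[OF this infinite_Ioi] show ?thesis
      unfolding E1_ce_def W column_coded by simp
  qed
  moreover have "\<not> Eset_ce \<phi> pair i j"
  proof -
    have "{} \<in> range (\<lambda>k. {i :: nat. i = 0 \<and> k \<le> n})"
      by (rule range_eqI[of _ _ "Suc n"]) auto
    then show ?thesis
      by (auto simp: Eset_ce_def W column_coded)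
  qed
  moreover have "\<not> Emax_ce \<phi> i j"
    using finite_coded_row[of 0 "\<lambda>_. True"] finite_coded_row[of 0 "\<lambda>k. k \<le> n"]
    by (auto simp: Emax_ce_def W coded_def)
  ultimately show "\<not> F i j" using assms by auto
next
  show "equivp F" using assms by (auto intro: equivp_intros)
  show "decidable 2 (\<lambda>xs. xs ! 1 = 0)" "decidable 2 (\<lambda>xs. xs ! 1 = 0 \<and> xs ! 0 \<le> n)" for n
    by (intro decidable_intros; simp)+
qed (auto intro: equivp_intros)

text \<open>As in the chain for \<open>E3_ce\<close>, but with column 0 left empty, so that the
  limit also has an empty column and the set of columns is always \<open>{{}, {0}}\<close>. Columns
  still differ in at most one element, so \<open>E3_ce\<close> needs a different chain.\<close>

lemma Eset_not_learn_reducible_E1_Emax: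
  assumes "F \<in> {E1_ce \<phi> pair, Emax_ce \<phi>}"
  shows "\<not> learn_reducible \<phi> (Eset_ce \<phi> pair) F"
proof (rule not_learn_reducible_coded[where R = "\<lambda>k i. i = 0 \<and> 0 < k"
      and S = "\<lambda>n k i. i = 0 \<and> 0 < k \<and> k \<le> Suc n"])
  fix i j n
  assume W: "W \<phi> i = coded pair (\<lambda>k i. i = 0 \<and> 0 < k)"
    "W \<phi> j = coded pair (\<lambda>k i. i = 0 \<and> 0 < k \<and> k \<le> Suc n)"
  \<comment> \<open>Column 0 supplies \<open>{}\<close> and column 1 supplies \<open>{0}\<close>;
    the bound \<open>Suc n\<close> keeps column 1 present already for \<open>n = 0\<close>.\<close>
  have range_eq: "range (\<lambda>k :: nat. {i :: nat. i = 0 \<and> P k}) = {{}, {0}}" if "\<not> P 0" "P 1" for P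
  proof (rule equalityI)
    show "{{}, {0}} \<subseteq> range (\<lambda>k :: nat. {i :: nat. i = 0 \<and> P k})"
      using that by (auto intro: range_eqI[of _ _ 0] range_eqI[of _ _ 1])
  qed auto
  show "Eset_ce \<phi> pair i j"
    by (simp add: Eset_ce_def W column_coded range_eq del: One_nat_def)
  have "\<not> E1_ce \<phi> pair i j"
  proof -
    have "{Suc n<..} \<subseteq> {k. {i :: nat. i = 0 \<and> 0 < k} \<noteq> {i. i = 0 \<and> 0 < k \<and> k \<le> Suc n}}"
      by (intro subsetI CollectI) (simp add: set_eq_iff)
    from infinite_super[OF this infinite_Ioi] show ?thesis
      unfolding E1_ce_def W column_coded by simp
  qed
  moreover have "\<not> Emax_ce \<phi> i j"
  proof -
    have "{k. 0 < k} = {0 :: nat<..}" "{k. 0 < k \<and> k \<le> Suc n} = {0<..Suc n}" by auto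
    then show ?thesis
      unfolding Emax_ce_def W finite_coded_row by (auto simp: coded_def infinite_Ioi)
  qed
  ultimately show "\<not> F i j" using assms by auto
next
  show "equivp F" using assms by (auto intro: equivp_intros)
  show "decidable 2 (\<lambda>xs. xs ! 1 = 0 \<and> 0 < xs ! 0)"
    "decidable 2 (\<lambda>xs. xs ! 1 = 0 \<and> 0 < xs ! 0 \<and> xs ! 0 \<le> Suc n)" for n
    by (intro decidable_intros; simp)+
  show "i = 0 \<and> 0 < k \<longleftrightarrow> (\<exists>n. i = 0 \<and> 0 < k \<and> k \<le> Suc n)" for k i :: nat
    by (auto intro: exI[of _ k])
qed (auto intro: equivp_intros)

text \<open>
  Column \<open>k \<ge> 2\<close> of either set is \<open>{..<k}\<close> and column 1 is everything, so replacing the full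
  column 0 by \<open>{..n + 1}\<close> changes infinitely much of it but not the set of columns.
\<close>

lemma Eset_not_learn_reducible_E3: "\<not> learn_reducible \<phi> (Eset_ce \<phi> pair) (E3_ce \<phi> pair)"
proof (rule not_learn_reducible_coded[where R = "\<lambda>k i. k \<le> 1 \<or> i < k"
      and S = "\<lambda>n k i. k = 0 \<and> i \<le> n + 1 \<or> k = 1 \<or> i < k"])
  fix i j n
  let ?R = "\<lambda>k i :: nat. k \<le> 1 \<or> i < k"
  let ?S = "\<lambda>k i :: nat. k = 0 \<and> i \<le> n + 1 \<or> k = 1 \<or> i < k"
  assume W: "W \<phi> i = coded pair ?R" "W \<phi> j = coded pair ?S"
  have same: "{i. ?R k i} = {i. ?S k i}" if "k \<noteq> 0" for k
    using that by auto
  \<comment> \<open>The full column lost at 0 survives as column 1, and the new column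
    \<open>{..n + 1}\<close> already occurs as column \<open>n + 2\<close>. The offset keeps that
    index at least 2, beyond the two full columns.\<close>
  have R0: "{i. ?R 0 i} = {i. ?S 1 i}" by auto
  have S0: "{i. ?S 0 i} = {i. ?R (n + 2) i}" by auto
  have range_eq: "range r = range s"
    if "\<And>k. k \<noteq> 0 \<Longrightarrow> r k = s k" "r 0 = s 1" "s 0 = r (n + 2)" for r s :: "nat \<Rightarrow> nat set"
  proof (intro equalityI image_subsetI)
    show "r k \<in> range s" for k
      using that(1)[of k] that(2) by (cases "k = 0") auto
    show "s k \<in> range r" for k
      using that(1)[of k, symmetric] that(3) by (cases "k = 0") auto
  qed
  have "range (\<lambda>k. {i. ?R k i}) = range (\<lambda>k. {i. ?S k i})"
    by (rule range_eq[OF same R0 S0])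
  then show "Eset_ce \<phi> pair i j"
    unfolding Eset_ce_def W column_coded .
  have "{i. ?R 0 i} - {i. ?S 0 i} = {n + 1<..}" by auto
  then have "infinite ({i. ?R 0 i} - {i. ?S 0 i})" by (simp only: infinite_Ioi not_False_eq_True)
  then show "\<not> E3_ce \<phi> pair i j"
    unfolding E3_ce_def W column_coded by blast
next
  fix k i :: nat
  show "(k \<le> 1 \<or> i < k) \<longleftrightarrow> (\<exists>n. k = 0 \<and> i \<le> n + 1 \<or> k = 1 \<or> i < k)"
    by (auto intro: exI[of _ i])
  show "decidable 2 (\<lambda>xs. xs ! 0 \<le> 1 \<or> xs ! 1 < xs ! 0)"
    "decidable 2 (\<lambda>xs. xs ! 0 = 0 \<and> xs ! 1 \<le> n + 1 \<or> xs ! 0 = 1 \<or> xs ! 1 < xs ! 0)" for n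
    by (intro decidable_intros; simp)+
qed (auto intro: equivp_intros)

end

theorem theorem5p8:
  fixes \<phi> :: "nat \<Rightarrow> nat \<Rightarrow> nat option"
    and pair :: "nat \<Rightarrow> nat \<Rightarrow> nat"
  assumes "acceptable_enumeration \<phi>"
    and "computable_pairing pair"
  shows "learn_incomparable \<phi> (E1_ce \<phi> pair) (E3_ce \<phi> pair) \<and>
         learn_incomparable \<phi> (E1_ce \<phi> pair) (Eset_ce \<phi> pair) \<and>
         learn_incomparable \<phi> (E1_ce \<phi> pair) (Emax_ce \<phi>) \<and>
         learn_incomparable \<phi> (E3_ce \<phi> pair) (Eset_ce \<phi> pair) \<and>
         learn_incomparable \<phi> (E3_ce \<phi> pair) (Emax_ce \<phi>) \<and>
         learn_incomparable \<phi> (Eset_ce \<phi> pair) (Emax_ce \<phi>)"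
proof -
  interpret enumerated \<phi> pair
    using assms by unfold_locales
  show ?thesis
    unfolding learn_incomparable_def
    by (simp add: Emax_not_learn_reducible E1_not_learn_reducible E3_not_learn_reducible
        Eset_not_learn_reducible_E1_Emax Eset_not_learn_reducible_E3)
qed

end
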